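(* Let $\mathbb{F}$ be a field, and let $A=[a_{i_1,\dots,i_d}]\in\mathbb{F}^{n_1\times\cdots\times n_{d-1}\times n}$ and $B=[b_{j_1,\dots,j_r}]\in\mathbb{F}^{n\times m_2\times\cdots\times m_r}$ be hypermatrices. Let $C=A\times^{i_d}_{j_1}B$ be their contracted product. Then $$M_C^{(i_1,\dots,i_{d-1})\times(j_2,\dots,j_r)}=M_A^{(i_1,\dots,i_{d-1})\times i_d}\; M_B^{j_1\times(j_2,\dots,j_r)},$$ where the product on the right-hand side is the conventional matrix product.
   Context: Write $\langle n\rangle=\{1,\dots,n\}$. A hypermatrix $A=[a_{i_1,\dots,i_d}]\in\mathbb{F}^{n_1\times\cdots\times n_d}$ is a function $\langle n_1\rangle\times\cdots\times\langle n_d\rangle\to\mathbb{F}$. Contracted product: $C=A\times^{i_d}_{j_1}B=[c_{i_1,\dots,i_{d-1},j_2,\dots,j_r}]\in\mathbb{F}^{n_1\times\cdots\times n_{d-1}\times m_2\times\cdots\times m_r}$ is defined by $$c_{i_1,\dots,i_{d-1},j_2,\dots,j_r}=\sum_{k=1}^n a_{i_1,\dots,i_{d-1},k}\,b_{k,j_2,\dots,j_r}.$$ Matrix expression: when the indices of a hypermatrix are split into two disjoint ordered lists $\mathbf{r}_1,\mathbf{r}_2$ exhausting all indices, $M_A^{\mathbf{r}_1\times\mathbf{r}_2}$ is the matrix whose rows are indexed by the values of the tuple of indices in $\mathbf{r}_1$ in lexicographic order (first entry most significant), whose columns are indexed by the values of the tuple of indices in $\mathbf{r}_2$ in lexicographic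 order, and whose entries are the corresponding entries of $A$. An empty list gives a single row (respectively, column). *)

theory Defs
  imports "Jordan_Normal_Form.Matrix"
begin

section \<open>Hypermatrices\<close>

definition index_tuples :: "nat list \<Rightarrow> nat list set" where
  "index_tuples ns = {t. length t = length ns \<and> (\<forall>k<length ns. t ! k \<in> {1..ns ! k})}"

text \<open>
  A hypermatrix carries its list of dimensions \<open>[n\<^sub>1, \<dots>, n\<^sub>d]\<close>; its entries
  form a function whose domain is exactly the set of index tuples. A hypermatrix of order 0
  (empty list of dimensions) has a single entry, at the empty tuple.
\<close>

typedef 'a hypermatrix =
  "{(ns, f). f \<in> extensional (index_tuples ns)} :: (nat list \<times> (nat list \<Rightarrow> 'a)) set"
  by (auto simp: extensional_def)

definition dims :: "'a hypermatrix \<Rightarrow> nat list" where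
  "dims A = fst (Rep_hypermatrix A)"

definition entry :: "'a hypermatrix \<Rightarrow> nat list \<Rightarrow> 'a" where
  "entry A = snd (Rep_hypermatrix A)"

definition hypermatrix :: "nat list \<Rightarrow> (nat list \<Rightarrow> 'a) \<Rightarrow> 'a hypermatrix" where
  "hypermatrix ns f = Abs_hypermatrix (ns, restrict f (index_tuples ns))"

lemma dims_hypermatrix [simp]: "dims (hypermatrix ns f) = ns"
  by (simp add: dims_def hypermatrix_def Abs_hypermatrix_inverse)

lemma entry_hypermatrix [simp]: "t \<in> index_tuples ns \<Longrightarrow> entry (hypermatrix ns f) t = f t"
  by (simp add: entry_def hypermatrix_def Abs_hypermatrix_inverse)

lemma hypermatrix_eqI:
  assumes d: "dims A = dims B"
    and e: "\<And>t. t \<in> index_tuples (dims A) \<Longrightarrow> entry A t = entry B t"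
  shows "A = B"
proof -
  have "entry A \<in> extensional (index_tuples (dims A))"
    using Rep_hypermatrix[of A] by (auto simp: dims_def entry_def)
  moreover have "entry B \<in> extensional (index_tuples (dims A))"
    using Rep_hypermatrix[of B] d by (auto simp: dims_def entry_def)
  ultimately have "entry A = entry B"
    using e by (rule extensionalityI)
  with d show ?thesis
    by (auto simp: dims_def entry_def Rep_hypermatrix_inject[symmetric] prod_eq_iff)
qed

text \<open>
  Contraction of the last index of \<open>A\<close> with the first index of \<open>B\<close>; meaningful when
  these two indices have the same dimension.
\<close>

definition contracted_product :: "'a::semiring_0 hypermatrix \<Rightarrow> 'a hypermatrix \<Rightarrow> 'a hypermatrix" where
  "contracted_product A B =
     hypermatrix (butlast (dims A) @ tl (dims B))
       (\<lambda>t. \<Sum>k = 1..last (dims A).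
          entry A (take (length (dims A) - 1) t @ [k]) *
          entry B (k # drop (length (dims A) - 1) t))"


section \<open>Matrix expressions\<close>

text \<open>
  The index positions of a hypermatrix of order \<open>d\<close> are \<open>1, \<dots>, d\<close>. For a list of
  positions \<open>r\<close>, \<open>select r\<close> extracts from a tuple the sub-tuple at these positions.
\<close>

definition select :: "nat list \<Rightarrow> 'b list \<Rightarrow> 'b list" where
  "select r t = map (\<lambda>k. t ! (k - 1)) r"

definition assemble :: "nat list \<Rightarrow> nat list \<Rightarrow> 'b list \<Rightarrow> 'b list \<Rightarrow> 'b list" where
  "assemble r1 r2 u v =
     map (\<lambda>k. the (map_of (zip (r1 @ r2) (u @ v)) k)) [1..<Suc (length (r1 @ r2))]"

text \<open>
  The library function \<^const>\<open>product_lists\<close> lets the last component vary fastest, so this is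
  the lexicographic enumeration of \<^term>\<open>index_tuples ns\<close>, as confirmed below.
\<close>

definition lex_tuples :: "nat list \<Rightarrow> nat list list" where
  "lex_tuples ns = product_lists (map (\<lambda>n. [1..<Suc n]) ns)"

text \<open>
  The matrix whose rows (columns) are indexed by the values of the indices at the positions
  \<open>r1\<close> (\<open>r2\<close>) in lexicographic order; \<open>r1\<close> and \<open>r2\<close> together must list each position of
  \<open>A\<close> exactly once. Matrix rows and columns are numbered from 0.
\<close>

definition matrix_expression :: "nat list \<Rightarrow> nat list \<Rightarrow> 'a hypermatrix \<Rightarrow> 'a mat" where
  "matrix_expression r1 r2 A =
     (let R = lex_tuples (select r1 (dims A));
          K = lex_tuples (select r2 (dims A))
      in mat (length R) (length K) (\<lambda>(p, q). entry A (assemble r1 r2 (R ! p) (K ! q))))"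

lemma set_lex_tuples: "set (lex_tuples ns) = index_tuples ns"
  by (auto simp: lex_tuples_def index_tuples_def product_lists_set list_all2_conv_all_nth
      less_Suc_eq_le simp del: upt_Suc)

lemma sorted_lex_tuples: "sorted_wrt (\<lambda>s t. (s, t) \<in> lexord {(i, j). i < j}) (lex_tuples ns)"
proof (induction ns)
  case Nil
  show ?case by (simp add: lex_tuples_def)
next
  case (Cons n ns)
  have *: "sorted_wrt (\<lambda>s t. (s, t) \<in> lexord {(i, j). i < j})
             (concat (map (\<lambda>i. map ((#) i) (lex_tuples ns)) is))"
    if "sorted_wrt (<) is" for "is" :: "nat list"
    using that Cons.IH
    by (induction "is") (auto simp: sorted_wrt_append sorted_wrt_map)
  show ?case
    using *[OF sorted_wrt_upt[of 1 "Suc n"]] by (simp add: lex_tuples_def del: upt_Suc)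
qed

lemma lex_tuples_Nil: "lex_tuples [] = [[]]"
  by (simp add: lex_tuples_def)

lemma assemble_select:
  assumes "distinct (r1 @ r2)" "set (r1 @ r2) = {1..d}" "length t = d"
  shows "assemble r1 r2 (select r1 t) (select r2 t) = t"
proof -
  have len: "length (r1 @ r2) = d"
    using assms distinct_card[of "r1 @ r2"] by simp
  have "map_of (zip (r1 @ r2) (map (\<lambda>k. t ! (k - 1)) (r1 @ r2))) k = Some (t ! (k - 1))"
    if "k \<in> {1..d}" for k
    using that assms(2) by (simp only: map_of_zip_map) (simp add: assms)
  then show ?thesis
    unfolding assemble_def select_def map_append[symmetric] len
    by (intro nth_equalityI) (simp_all add: assms del: upt_Suc)
qed

lemma matrix_expression_entry:
  fixes A :: "'a hypermatrix"
  defines "R r \<equiv> lex_tuples (select r (dims A))"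
  assumes "distinct (r1 @ r2)" "set (r1 @ r2) = {1..length (dims A)}"
    and t: "t \<in> index_tuples (dims A)"
    and "p < length (R r1)" "R r1 ! p = select r1 t"
    and "q < length (R r2)" "R r2 ! q = select r2 t"
  shows "matrix_expression r1 r2 A $$ (p, q) = entry A t"
  using assms assemble_select[OF assms(2,3), of t]
  by (simp add: matrix_expression_def Let_def index_tuples_def)

end

theory Submission
  imports Defs
begin

text \<open>
  All three matrix expressions cut the list of index positions into a leading and a trailing
  segment. For such a cut the index tuple belonging to row \<open>u\<close> and column \<open>v\<close> is simply the
  concatenation \<open>u @ v\<close> (\<open>matrix_expression_split\<close>), so the matrix is read off directly from the
  hypermatrix. The contracted index, as the single column index of \<open>A\<close> and the single row index
  of \<open>B\<close>, is enumerated by \<open>[1], \<dots>, [n]\<close> (\<open>lex_tuples_single\<close>). Hence the matrix product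
  at row \<open>u\<close> and column \<open>v\<close> is the sum of \<open>a\<^sub>u\<^sub>k b\<^sub>k\<^sub>v\<close> over \<open>k\<close>, which is the entry of the
  contracted product at \<open>u @ v\<close> (\<open>entry_contracted_product_append\<close>).
\<close>

lemma select_upt:
  assumes "b \<le> length t"
  shows "select [Suc a..<Suc b] t = take (b - a) (drop a t)"
  using assms by (intro nth_equalityI) (auto simp: select_def simp del: upt_Suc)

text \<open>
  Selecting at the two segments splits \<open>u @ v\<close> into \<open>u\<close> and \<open>v\<close>, and assembling inverts
  selecting.
\<close>

lemma assemble_split:
  "assemble [1..<Suc (length u)] [Suc (length u)..<Suc (length u + length v)] u v = u @ v"
proof -
  let ?r1 = "[1..<Suc (length u)]"
  let ?r2 = "[Suc (length u)..<Suc (length u + length v)]"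
  have "?r1 @ ?r2 = [1..<Suc (length u + length v)]"
    by (metis Suc_le_mono le_add1 One_nat_def le0 upt_add_eq_append add_Suc)
  then have "distinct (?r1 @ ?r2)" "set (?r1 @ ?r2) = {1..length u + length v}"
    by (simp_all only: distinct_upt set_upt atLeastLessThanSuc_atLeastAtMost)
  from assemble_select[OF this, of "u @ v"] show ?thesis
    using select_upt[of "length u" "u @ v" 0]
      select_upt[of "length u + length v" "u @ v" "length u"]
    by (simp del: upt_Suc)
qed

lemma matrix_expression_split:
  assumes "dims A = us @ vs"
  shows "matrix_expression [1..<Suc (length us)]
             [Suc (length us)..<Suc (length us + length vs)] A =
         mat (length (lex_tuples us)) (length (lex_tuples vs))
           (\<lambda>(p, q). entry A (lex_tuples us ! p @ lex_tuples vs ! q))"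
proof -
  have select: "select [1..<Suc (length us)] (dims A) = us"
    "select [Suc (length us)..<Suc (length us + length vs)] (dims A) = vs"
    using select_upt[of "length us" "dims A" 0]
      select_upt[of "length us + length vs" "dims A" "length us"]
    by (simp_all add: assms del: upt_Suc)
  have "length (lex_tuples ns ! p) = length ns" if "p < length (lex_tuples ns)" for ns p
    using nth_mem[OF that] by (simp add: set_lex_tuples index_tuples_def)
  then have "assemble [1..<Suc (length us)] [Suc (length us)..<Suc (length us + length vs)]
        (lex_tuples us ! p) (lex_tuples vs ! q) = lex_tuples us ! p @ lex_tuples vs ! q"
    if "p < length (lex_tuples us)" "q < length (lex_tuples vs)" for p q
    using assemble_split[of "lex_tuples us ! p" "lex_tuples vs ! q"] that by metis
  then show ?thesis
    unfolding matrix_expression_def select Let_def by (intro eq_matI) auto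
qed

lemma lex_tuples_single: "lex_tuples [n] = map (\<lambda>k. [k]) [1..<Suc n]"
  by (simp add: lex_tuples_def del: upt_Suc)

lemma append_in_index_tuples:
  assumes "u \<in> index_tuples ns" "v \<in> index_tuples ms"
  shows "u @ v \<in> index_tuples (ns @ ms)"
  using assms by (auto simp: index_tuples_def nth_append)

text \<open>
  The contracted product cuts a tuple at the order of \<open>A\<close> minus one, which is the length of
  \<open>u\<close>; so the cut of \<open>u @ v\<close> returns \<open>u\<close> and \<open>v\<close>.
\<close>

lemma entry_contracted_product_append:
  assumes "dims A = ns @ [n]" "dims B = n # ms"
    and "u \<in> index_tuples ns" "v \<in> index_tuples ms"
  shows "entry (contracted_product A B) (u @ v) =
         (\<Sum>k = 1..n. entry A (u @ [k]) * entry B (k # v))"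
  using assms append_in_index_tuples[OF assms(3,4)]
  by (simp add: contracted_product_def index_tuples_def[of ns])

theorem proposition11:
  fixes A B C :: "'a::field hypermatrix"
    and ns ms :: "nat list" and n d r :: nat
  assumes "dims A = ns @ [n]" and "length (dims A) = d"
    and "dims B = n # ms" and "length (dims B) = r"
    and "C = contracted_product A B"
  shows "matrix_expression [1..<d] [d..<d + r - 1] C =
         matrix_expression [1..<d] [d] A * matrix_expression [1] [2..<r + 1] B"
proof -
  let ?N = "lex_tuples ns" and ?M = "lex_tuples ms"
  have d: "d = Suc (length ns)" and r: "r = Suc (length ms)"
    using assms by auto
  have C: "matrix_expression [1..<d] [d..<d + r - 1] C =
      mat (length ?N) (length ?M) (\<lambda>(p, q). entry C (?N ! p @ ?M ! q))"
    using matrix_expression_split[of C ns ms] assms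
    by (simp add: d r contracted_product_def del: upt_Suc)
  have A: "matrix_expression [1..<d] [d] A =
      mat (length ?N) n (\<lambda>(p, k). entry A (?N ! p @ [Suc k]))"
  proof -
    have "[d] = [Suc (length ns)..<Suc (length ns + length [n])]"
      by (simp add: d)
    then show ?thesis
      using matrix_expression_split[of A ns "[n]"] assms(1)
      by (auto simp: d lex_tuples_single simp del: upt_Suc intro!: eq_matI)
  qed
  have B: "matrix_expression [1] [2..<r + 1] B =
      mat n (length ?M) (\<lambda>(k, q). entry B (Suc k # ?M ! q))"
  proof -
    have "[1] = [1..<Suc (length [n])]"
      by simp
    then show ?thesis
      using matrix_expression_split[of B "[n]" ms] assms(3)
      by (auto simp: r lex_tuples_single numeral_2_eq_2 simp del: upt_Suc intro!: eq_matI)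
  qed
  show ?thesis
    unfolding A B C
  proof (rule eq_matI, goal_cases)
    case (1 p q)
    then have p: "p < length ?N" and q: "q < length ?M" by auto
    then have "?N ! p \<in> index_tuples ns" "?M ! q \<in> index_tuples ms"
      using nth_mem set_lex_tuples by blast+
    then have "entry C (?N ! p @ ?M ! q) =
        (\<Sum>k = 1..n. entry A (?N ! p @ [k]) * entry B (k # ?M ! q))"
      using entry_contracted_product_append assms by blast
    \<comment> \<open>tuple entries count from 1, matrix columns and rows from 0\<close>
    also have "\<dots> = (\<Sum>k = 0..<n. entry A (?N ! p @ [Suc k]) * entry B (Suc k # ?M ! q))"
      by (simp add: sum.atLeast_Suc_atMost_Suc_shift sum.shift_bounds_Suc_ivl
          atLeastLessThanSuc_atLeastAtMost[symmetric] del: sum.op_ivl_Suc)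
    finally show ?case
      using p q by (simp add: scalar_prod_def)
  qed auto
qed

end
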